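(* Every inner product on the Lie algebra $A_{3,1}\oplus 2A_1$ is a nilsoliton.
   Context: $\mathfrak{g}=A_{3,1}\oplus 2A_1$ is the five-dimensional real nilpotent Lie algebra having a basis $\{v_1,\dots,v_5\}$ whose only nonzero bracket (up to antisymmetry) is $[v_1,v_2]=\alpha v_5$ with $\alpha>0$ (all choices of $\alpha>0$ give isomorphic Lie algebras). An inner product on $\mathfrak{g}$ is identified with the left-invariant Riemannian metric $g$ it induces on the simply connected Lie group $G$ with Lie algebra $\mathfrak{g}$. Let $ric_g$ be the Ricci curvature tensor of $(G,g)$ (Levi-Civita connection), viewed as a symmetric bilinear form on $\mathfrak{g}$; since $\mathfrak{g}$ is nilpotent, $ric_g(u,v)=-\frac12\mathrm{tr}(ad_u\circ ad_v^* )-\frac14\mathrm{tr}(J_u\circ J_v)$, where $ad_uv=[u,v]$, $ad_v^*$ is the $g$-transpose of $ad_v$, and $J_uv=ad_v^*u$. The Ricci operator $Ric_g$ is defined by $ric_g(u,v)=g(Ric_g(u),v)$. The metric $g$ is a nilsoliton if $Ric_g\in\mathbb{R}\,\mathrm{Id}_{\mathfrak{g}}\oplus Der(\mathfrak{g})$, i.e. $Ric_g=c\,\mathrm{Id}+D$ for some $c\in\mathbb{R}$ and some derivation $D$ of $\mathfrak{g}$. *)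

theory Defs
  imports "HOL-Analysis.Analysis"
begin

section \<open>Lie algebra structures on \<open>\<real>\<^sup>n\<close>\<close>

definition lie_bracket :: "(real^'n \<Rightarrow> real^'n \<Rightarrow> real^'n) \<Rightarrow> bool" where
  "lie_bracket br \<longleftrightarrow> bilinear br \<and> (\<forall>x. br x x = 0) \<and>
     (\<forall>x y z. br x (br y z) + br y (br z x) + br z (br x y) = 0)"

definition lie_derivation ::
    "(real^'n \<Rightarrow> real^'n \<Rightarrow> real^'n) \<Rightarrow> (real^'n \<Rightarrow> real^'n) \<Rightarrow> bool" where
  "lie_derivation br D \<longleftrightarrow> linear D \<and> (\<forall>x y. D (br x y) = br (D x) y + br x (D y))"

definition A31_plus_2A1 :: "(real^5 \<Rightarrow> real^5 \<Rightarrow> real^5) \<Rightarrow> bool" where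
  "A31_plus_2A1 br \<longleftrightarrow> lie_bracket br \<and>
     (\<exists>(v :: nat \<Rightarrow> real^5) \<alpha>::real. \<alpha> > 0 \<and>
        inj_on v {1..5} \<and> independent (v ` {1..5}) \<and> span (v ` {1..5}) = UNIV \<and>
        (\<forall>i\<in>{1..5}. \<forall>j\<in>{1..5}. i < j \<longrightarrow>
           br (v i) (v j) = (if i = 1 \<and> j = 2 then \<alpha> *\<^sub>R v 5 else 0)))"

section \<open>Left-invariant metrics\<close>

text \<open>The metric is an arbitrary inner product, unrelated to the standard one \<open>(\<bullet>)\<close>
  on \<open>\<real>\<^sup>n\<close>.\<close>

definition inner_product :: "(real^'n \<Rightarrow> real^'n \<Rightarrow> real) \<Rightarrow> bool" where
  "inner_product g \<longleftrightarrow> bilinear g \<and> (\<forall>x y. g x y = g y x) \<and> (\<forall>x. x \<noteq> 0 \<longrightarrow> g x x > 0)"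

text \<open>The geometry of the simply connected Lie group with Lie algebra \<open>(\<real>\<^sup>n, br)\<close> and
  left-invariant metric \<open>g\<close> is expressed on left-invariant vector fields, which are identified
  with elements of \<open>\<real>\<^sup>n\<close>. The Levi-Civita connection maps left-invariant fields to left-invariant
  fields, and since \<open>g\<close> is constant on such fields, metric compatibility is
  \<open>0 = g (\<nabla>\<^sub>x y) z + g y (\<nabla>\<^sub>x z)\<close>. Existence and uniqueness are proved below.\<close>

definition is_levi_civita :: "(real^'n \<Rightarrow> real^'n \<Rightarrow> real^'n) \<Rightarrow> (real^'n \<Rightarrow> real^'n \<Rightarrow> real)
    \<Rightarrow> (real^'n \<Rightarrow> real^'n \<Rightarrow> real^'n) \<Rightarrow> bool" where
  "is_levi_civita br g nab \<longleftrightarrow> bilinear nab \<and>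
     (\<forall>x y. nab x y - nab y x = br x y) \<and>
     (\<forall>x y z. g (nab x y) z + g y (nab x z) = 0)"

definition levi_civita :: "(real^'n \<Rightarrow> real^'n \<Rightarrow> real^'n) \<Rightarrow> (real^'n \<Rightarrow> real^'n \<Rightarrow> real)
    \<Rightarrow> real^'n \<Rightarrow> real^'n \<Rightarrow> real^'n" where
  "levi_civita br g = (THE nab. is_levi_civita br g nab)"

definition riemann :: "(real^'n \<Rightarrow> real^'n \<Rightarrow> real^'n) \<Rightarrow> (real^'n \<Rightarrow> real^'n \<Rightarrow> real)
    \<Rightarrow> real^'n \<Rightarrow> real^'n \<Rightarrow> real^'n \<Rightarrow> real^'n" where
  "riemann br g x y z = (let nab = levi_civita br g in
     nab x (nab y z) - nab y (nab x z) - nab (br x y) z)"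

abbreviation op_trace :: "(real^'n \<Rightarrow> real^'n) \<Rightarrow> real" where
  "op_trace f \<equiv> trace (matrix f)"

definition ricci :: "(real^'n \<Rightarrow> real^'n \<Rightarrow> real^'n) \<Rightarrow> (real^'n \<Rightarrow> real^'n \<Rightarrow> real)
    \<Rightarrow> real^'n \<Rightarrow> real^'n \<Rightarrow> real" where
  "ricci br g u v = op_trace (\<lambda>w. riemann br g w u v)"

definition ricci_operator :: "(real^'n \<Rightarrow> real^'n \<Rightarrow> real^'n) \<Rightarrow> (real^'n \<Rightarrow> real^'n \<Rightarrow> real)
    \<Rightarrow> real^'n \<Rightarrow> real^'n" where
  "ricci_operator br g = (THE A. \<forall>u v. ricci br g u v = g (A u) v)"

definition nilsoliton :: "(real^'n \<Rightarrow> real^'n \<Rightarrow> real^'n) \<Rightarrow> (real^'n \<Rightarrow> real^'n \<Rightarrow> real) \<Rightarrow> bool"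
  where "nilsoliton br g \<longleftrightarrow>
    (\<exists>c D. lie_derivation br D \<and> ricci_operator br g = (\<lambda>x. c *\<^sub>R x + D x))"

section \<open>Well-definedness, and the Ricci formula in the nilpotent case\<close>

definition g_transpose :: "(real^'n \<Rightarrow> real^'n \<Rightarrow> real) \<Rightarrow> (real^'n \<Rightarrow> real^'n) \<Rightarrow> real^'n \<Rightarrow> real^'n"
  where "g_transpose g f = (THE h. \<forall>x y. g (h x) y = g x (f y))"

definition J_map :: "(real^'n \<Rightarrow> real^'n \<Rightarrow> real^'n) \<Rightarrow> (real^'n \<Rightarrow> real^'n \<Rightarrow> real)
    \<Rightarrow> real^'n \<Rightarrow> real^'n \<Rightarrow> real^'n" where
  "J_map br g u v = g_transpose g (br v) u"

fun lower_central :: "(real^'n \<Rightarrow> real^'n \<Rightarrow> real^'n) \<Rightarrow> nat \<Rightarrow> (real^'n) set" where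
  "lower_central br 0 = UNIV"
| "lower_central br (Suc n) = span {br x y | x y. y \<in> lower_central br n}"

definition nilpotent_lie :: "(real^'n \<Rightarrow> real^'n \<Rightarrow> real^'n) \<Rightarrow> bool" where
  "nilpotent_lie br \<longleftrightarrow> (\<exists>n. lower_central br n = {0})"

lemma inner_productD:
  assumes "inner_product g"
  shows "bilinear g" and "g x y = g y x" and "x \<noteq> 0 \<Longrightarrow> g x x > 0"
  using assms unfolding inner_product_def by blast+

lemma inner_product_eqI:
  assumes g: "inner_product g" and eq: "\<And>z. g a z = g b z"
  shows "a = b"
proof (rule ccontr)
  assume "a \<noteq> b"
  then have "g (a - b) (a - b) > 0" using inner_productD(3)[OF g] by simp
  moreover have "g (a - b) (a - b) = 0"
    using eq by (simp add: bilinear_lsub[OF inner_productD(1)[OF g]])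
  ultimately show False by simp
qed

lemma gram_map:
  fixes g :: "real^'n \<Rightarrow> real^'n \<Rightarrow> real"
  assumes g: "inner_product g"
  obtains T where "linear T" "bij T" "\<And>a z. T a \<bullet> z = g a z"
proof -
  note bg = inner_productD(1)[OF g]
  define T where "T a = (\<chi> i. g a (axis i 1))" for a :: "real^'n"
  have lT: "linear T"
    by (rule linearI) (simp_all add: T_def vec_eq_iff bilinear_ladd[OF bg] bilinear_lmul[OF bg])
  have Tz: "T a \<bullet> z = g a z" for a z
  proof -
    have lin: "linear (g a)" using bg unfolding bilinear_def by blast
    have "g a z = g a (\<Sum>i\<in>UNIV. (z $ i) *\<^sub>R axis i 1)"
      by (simp add: basis_expansion scalar_mult_eq_scaleR[symmetric])
    also have "\<dots> = (\<Sum>i\<in>UNIV. (z $ i) * g a (axis i 1))"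
      by (simp add: linear_sum[OF lin] linear_scale[OF lin])
    finally show ?thesis by (simp add: T_def inner_vec_def mult.commute)
  qed
  have "inj T"
    by (rule injI) (metis Tz inner_product_eqI[OF g])
  then have "bij T"
    using linear_injective_imp_surjective[OF lT] by (simp add: bij_def)
  with lT Tz show ?thesis using that by blast
qed

lemma riesz:
  fixes \<phi> :: "real^'n \<Rightarrow> real"
  assumes g: "inner_product g" and \<phi>: "linear \<phi>"
  shows "\<exists>!a. \<forall>z. g a z = \<phi> z"
proof -
  obtain T where T: "linear T" "bij T" "\<And>a z. T a \<bullet> z = g a z" using gram_map[OF g] by blast
  have *: "\<phi> z = adjoint \<phi> 1 \<bullet> z" for z
    using adjoint_works[OF \<phi>, of z 1] by (simp add: inner_commute)
  obtain a where "T a = adjoint \<phi> 1" using T(2) by (metis bij_pointE)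
  then have a: "g a z = \<phi> z" for z using T(3)[of a z] *[of z] by simp
  show ?thesis
    by (rule ex1I[of _ a]) (auto simp: a intro!: inner_product_eqI[OF g])
qed

lemma g_transpose_works:
  fixes f :: "real^'n \<Rightarrow> real^'n"
  assumes g: "inner_product g" and f: "linear f"
  shows "g (g_transpose g f x) y = g x (f y)"
proof -
  have "linear (\<lambda>y. g x (f y))" for x
    using inner_productD(1)[OF g] f linear_compose[OF f, of "g x"]
    by (simp add: bilinear_def o_def)
  then have "\<forall>x. \<exists>a. \<forall>y. g a y = g x (f y)"
    using riesz[OF g] by blast
  then obtain h where h: "\<And>x y. g (h x) y = g x (f y)"
    by metis
  have "g_transpose g f = h"
    unfolding g_transpose_def
    by (rule the_equality) (auto simp: h intro!: ext inner_product_eqI[OF g])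
  with h show ?thesis by simp
qed

lemma g_transpose_eqI:
  assumes g: "inner_product g" and f: "linear f" and h: "\<And>x y. g (h x) y = g x (f y)"
  shows "g_transpose g f = h"
  by (rule ext, rule inner_product_eqI[OF g]) (simp add: g_transpose_works[OF g f] h)

lemma g_transpose_linear:
  assumes g: "inner_product g" and f: "linear f"
  shows "linear (g_transpose g f)"
proof -
  note bg = inner_productD(1)[OF g]
  show ?thesis
    by (rule linearI; rule inner_product_eqI[OF g])
      (simp_all add: g_transpose_works[OF g f] bilinear_ladd[OF bg] bilinear_lmul[OF bg])
qed

lemma op_trace_comm:
  assumes "linear f" "linear h"
  shows "op_trace (\<lambda>x. f (h x)) = op_trace (\<lambda>x. h (f x))"
  using matrix_compose[OF assms(2,1)] matrix_compose[OF assms]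
    trace_mul_sym[of "matrix f" "matrix h"]
  unfolding o_def by metis

lemma op_trace_add: "op_trace (\<lambda>x. f x + h x) = op_trace f + op_trace h"
  by (simp add: trace_def matrix_def sum.distrib)

lemma op_trace_scale: "op_trace (\<lambda>x. c *\<^sub>R f x) = c * op_trace f"
  by (simp add: trace_def matrix_def sum_distrib_left)

lemma op_trace_minus: "op_trace (\<lambda>x. - f x) = - op_trace f"
  by (simp add: trace_def matrix_def sum_negf)

lemma op_trace_diff: "op_trace (\<lambda>x. f x - h x) = op_trace f - op_trace h"
  by (simp add: trace_def matrix_def sum_subtractf)

lemma op_trace_g_adjoint:
  fixes f h :: "real^'n \<Rightarrow> real^'n"
  assumes g: "inner_product g" and f: "linear f" and h: "linear h"
    and adj: "\<And>x y. g (h x) y = g x (f y)"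
  shows "op_trace h = op_trace f"
proof -
  obtain T where T: "linear T" "bij T" "\<And>a z. T a \<bullet> z = g a z" using gram_map[OF g] by blast
  obtain S where S: "linear S" "S \<circ> T = id"
    using linear_injective_left_inverse[OF T(1)] T(2) by (auto simp: bij_def)
  have ST: "S (T x) = x" for x using S(2) by (metis comp_apply id_apply)
  have TS: "T (S x) = x" for x using ST T(2) by (metis bij_pointE)
  have la: "linear (adjoint f)" using f by (rule adjoint_linear)
  have Th: "T (h x) = adjoint f (T x)" for x
  proof -
    have "T (h x) \<bullet> y = adjoint f (T x) \<bullet> y" for y
      using adj[of x y] adjoint_works[OF f, of y "T x"] T(3)[of "h x" y] T(3)[of x "f y"]
      by (metis inner_commute)
    then show ?thesis using vector_eq_rdot by blast
  qed
  have "h = (\<lambda>x. S (adjoint f (T x)))" by (metis Th ST)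
  then have "op_trace h = op_trace (\<lambda>x. S (adjoint f (T x)))" by simp
  also have "\<dots> = op_trace (\<lambda>x. adjoint f (T (S x)))"
    using op_trace_comm[OF S(1) linear_compose[OF T(1) la]] by (simp add: o_def)
  also have "\<dots> = op_trace (adjoint f)" by (simp add: TS)
  also have "\<dots> = op_trace f" by (simp add: matrix_adjoint[OF f] trace_def transpose_def)
  finally show ?thesis .
qed

lemma op_trace_filtration:
  fixes f :: "real^'n \<Rightarrow> real^'n" and S :: "nat \<Rightarrow> (real^'n) set"
  assumes f: "linear f" and S: "\<And>i. subspace (S i)" and dec: "\<And>i. S (Suc i) \<subseteq> S i"
    and S0: "S 0 = UNIV" and Sn: "S n = {0}" and fS: "\<And>i x. x \<in> S i \<Longrightarrow> f x \<in> S (Suc i)"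
  shows "op_trace f = 0"
proof -
  have "\<exists>Q. range Q \<subseteq> S i \<and> linear Q \<and> (\<forall>v\<in>S i. Q v = v)" for i
    using linear_exists_left_inverse_on[OF linear_id S[of i]] by (auto simp: id_def inj_on_def)
  then obtain Q where Q: "\<And>i. range (Q i) \<subseteq> S i" "\<And>i. linear (Q i)"
    "\<And>i v. v \<in> S i \<Longrightarrow> Q i v = v" by metis
  have Qi: "Q i x \<in> S i" for i x using Q(1) by blast
  have step: "op_trace (\<lambda>x. f (Q i x)) = op_trace (\<lambda>x. f (Q (Suc i) x))" for i
  proof -
    have "op_trace (\<lambda>x. f (Q i x)) = op_trace (\<lambda>x. Q (Suc i) (f (Q i x)))"
      by (simp add: Q(3) fS Qi)
    also have "\<dots> = op_trace (\<lambda>x. f (Q i (Q (Suc i) x)))"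
      using op_trace_comm[OF Q(2) linear_compose[OF Q(2) f]] by (simp add: o_def)
    also have "\<dots> = op_trace (\<lambda>x. f (Q (Suc i) x))"
      using Q(3) Qi dec by (simp add: subset_iff)
    finally show ?thesis .
  qed
  have "op_trace (\<lambda>x. f (Q k x)) = op_trace f" for k
    by (induction k) (use step Q(3)[of _ 0] S0 in auto)
  from this[of n] have "op_trace f = op_trace (\<lambda>x. f (Q n x))" by simp
  also have "(\<lambda>x. f (Q n x)) = (\<lambda>x. 0)" using Qi[of n] Sn linear_0[OF f] by auto
  finally show ?thesis by (simp add: trace_def matrix_def)
qed

lemma lie_bracketD:
  assumes "lie_bracket br"
  shows "bilinear br" and "br x x = 0" and "br x y = - br y x"
proof -
  show b: "bilinear br" and d: "br x x = 0" for x using assms unfolding lie_bracket_def by blast+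
  have "br (x + y) (x + y) = br x x + br y x + (br x y + br y y)"
    by (simp only: bilinear_ladd[OF b] bilinear_radd[OF b])
  then show "br x y = - br y x" by (simp add: d eq_neg_iff_add_eq_0 add.commute)
qed

lemma lie_bracket_linear:
  assumes "lie_bracket br"
  shows "linear (br x)" and "linear (\<lambda>x. br x y)"
  using lie_bracketD(1)[OF assms] unfolding bilinear_def by blast+

lemma lower_central_filtration:
  assumes br: "lie_bracket br"
  shows "subspace (lower_central br i)"
    and "lower_central br (Suc i) \<subseteq> lower_central br i"
    and "y \<in> lower_central br i \<Longrightarrow> br x y \<in> lower_central br (Suc i)"
proof -
  show "subspace (lower_central br i)" for i by (cases i) simp_all
  show "lower_central br (Suc i) \<subseteq> lower_central br i"
  proof (induction i)
    case (Suc i)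
    then have "{br x y |x y. y \<in> lower_central br (Suc i)} \<subseteq> {br x y |x y. y \<in> lower_central br i}"
      by blast
    then show ?case
      unfolding lower_central.simps(2)[of br "Suc i"] lower_central.simps(2)[of br i]
      by (rule span_mono)
  qed simp
  show "y \<in> lower_central br i \<Longrightarrow> br x y \<in> lower_central br (Suc i)"
    by (auto intro!: span_base)
qed

lemma nilpotent_traces:
  assumes br: "lie_bracket br" and nil: "nilpotent_lie br"
  shows "op_trace (br x) = 0" and "op_trace (\<lambda>z. br x (br y z)) = 0"
proof -
  obtain n where n: "lower_central br n = {0}" using nil unfolding nilpotent_lie_def by blast
  note lcs = lower_central_filtration[OF br]
  note lin = lie_bracket_linear(1)[OF br]
  show "op_trace (br x) = 0"
    by (rule op_trace_filtration[OF lin lcs(1,2) _ n lcs(3)]) simp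
  have lxy: "linear (\<lambda>z. br x (br y z))"
    using linear_compose[OF lin lin] by (simp add: o_def)
  show "op_trace (\<lambda>z. br x (br y z)) = 0"
    by (rule op_trace_filtration[OF lxy lcs(1,2) _ n]) (use lcs(2,3) in \<open>(simp, blast)\<close>)
qed

lemma koszul:
  assumes br: "lie_bracket br" and g: "inner_product g" and n: "is_levi_civita br g nab"
  shows "2 * g (nab x y) z = g (br x y) z - g (br y z) x + g (br z x) y"
proof -
  note bg = inner_productD(1)[OF g]
  have tor: "br x y = nab x y - nab y x"
    and comp: "g (nab x y) z = - g (nab x z) y" for x y z
    using n inner_productD(2)[OF g] unfolding is_levi_civita_def
    by (auto simp: eq_neg_iff_add_eq_0)
  show ?thesis
    unfolding tor bilinear_lsub[OF bg]
    using comp[of x y z] comp[of y x z] comp[of z x y] by linarith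
qed

lemma J_map_works:
  assumes br: "lie_bracket br" and g: "inner_product g"
  shows "g (J_map br g u v) w = g u (br v w)"
  unfolding J_map_def by (rule g_transpose_works[OF g lie_bracket_linear(1)[OF br]])

lemma levi_civita_explicit:
  assumes br: "lie_bracket br" and g: "inner_product g"
  defines "nab \<equiv> \<lambda>x y. (1/2) *\<^sub>R (br x y - J_map br g y x - J_map br g x y)"
  shows "is_levi_civita br g nab"
proof -
  note bg = inner_productD(1)[OF g] and bb = lie_bracketD(1)[OF br]
  note lin = bilinear_ladd[OF bg] bilinear_lmul[OF bg] bilinear_lsub[OF bg]
    bilinear_radd[OF bg] bilinear_rmul[OF bg]
    bilinear_ladd[OF bb] bilinear_lmul[OF bb] bilinear_radd[OF bb] bilinear_rmul[OF bb]
  have *: "g (nab x y) z = (1/2) * (g (br x y) z - g y (br x z) - g x (br y z))" for x y z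
    by (simp add: nab_def lin J_map_works[OF br g])
  have asym: "g x (br y z) = - g x (br z y)" for x y z
    by (subst lie_bracketD(3)[OF br]) (simp add: bilinear_rneg[OF bg])
  have "bilinear nab"
    unfolding bilinear_def
    by (intro conjI allI linearI; rule inner_product_eqI[OF g])
      (simp_all add: * lin algebra_simps)
  moreover have "nab x y - nab y x = br x y" for x y
    by (rule inner_product_eqI[OF g])
      (use asym[of _ y x] in \<open>simp add: bilinear_lsub[OF bg] *
        inner_productD(2)[OF g, of "br _ _"] field_simps\<close>)
  moreover have "g (nab x y) z + g y (nab x z) = 0" for x y z
    using *[of x y z] *[of x z y] asym[of x z y] inner_productD(2)[OF g, of y "nab x z"]
      inner_productD(2)[OF g, of y "br x z"] inner_productD(2)[OF g, of z "br x y"]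
    by (simp add: field_simps)
  ultimately show ?thesis unfolding is_levi_civita_def by blast
qed

theorem levi_civita_ex1:
  assumes br: "lie_bracket br" and g: "inner_product g"
  shows "\<exists>!nab. is_levi_civita br g nab"
proof (rule ex1I, rule levi_civita_explicit[OF br g])
  fix nab assume n: "is_levi_civita br g nab"
  show "nab = (\<lambda>x y. (1/2) *\<^sub>R (br x y - J_map br g y x - J_map br g x y))"
  proof (intro ext, rule inner_product_eqI[OF g])
    fix x y z
    show "g (nab x y) z = g ((1/2) *\<^sub>R (br x y - J_map br g y x - J_map br g x y)) z"
      using koszul[OF br g n, of x y z]
        koszul[OF br g levi_civita_explicit[OF br g], of x y z] by simp
  qed
qed

lemma levi_civita_eq:
  assumes br: "lie_bracket br" and g: "inner_product g"
  shows "levi_civita br g = (\<lambda>x y. (1/2) *\<^sub>R (br x y - J_map br g y x - J_map br g x y))"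
  unfolding levi_civita_def
  by (rule the1_equality) (rule levi_civita_ex1[OF br g], rule levi_civita_explicit[OF br g])

lemma is_levi_civita_levi_civita:
  assumes "lie_bracket br" and "inner_product g"
  shows "is_levi_civita br g (levi_civita br g)"
  using levi_civita_explicit[OF assms] levi_civita_eq[OF assms] by simp

theorem ricci_operator_works:
  assumes br: "lie_bracket br" and g: "inner_product g"
  shows "ricci br g u v = g (ricci_operator br g u) v"
proof -
  have bn: "bilinear (levi_civita br g)"
    using is_levi_civita_levi_civita[OF br g] unfolding is_levi_civita_def by blast
  have "riemann br g w u (x + y) = riemann br g w u x + riemann br g w u y"
    and "riemann br g w u (c *\<^sub>R x) = c *\<^sub>R riemann br g w u x" for w u x y c
    by (simp_all add: riemann_def Let_def bilinear_radd[OF bn] bilinear_rmul[OF bn] algebra_simps)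
  then have "linear (ricci br g u)" for u
    by (intro linearI) (simp_all add: ricci_def op_trace_add op_trace_scale)
  then have "\<forall>u. \<exists>a. \<forall>v. g a v = ricci br g u v"
    using riesz[OF g] by blast
  then obtain A where A: "\<And>u v. g (A u) v = ricci br g u v" by metis
  have "ricci_operator br g = A"
    unfolding ricci_operator_def
    by (rule the_equality) (auto simp: A intro!: ext inner_product_eqI[OF g])
  with A show ?thesis by simp
qed

theorem ricci_nilpotent:
  fixes br :: "real^'n \<Rightarrow> real^'n \<Rightarrow> real^'n"
  assumes br: "lie_bracket br" and nil: "nilpotent_lie br" and g: "inner_product g"
  shows "ricci br g u v = - (1/2) * op_trace (br u \<circ> g_transpose g (br v))
                          - (1/4) * op_trace (J_map br g u \<circ> J_map br g v)"
proof -
  note bg = inner_productD(1)[OF g]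
  define nab where "nab = levi_civita br g"
  define A where "A = br"
  define B where "B = (\<lambda>x. g_transpose g (br x))"
  define J where "J = J_map br g"
  have bn: "bilinear nab"
    using is_levi_civita_levi_civita[OF br g] unfolding is_levi_civita_def nab_def by blast
  have lA: "linear (A x)" for x unfolding A_def by (rule lie_bracket_linear(1)[OF br])
  have lB: "linear (B x)" for x
    unfolding B_def by (rule g_transpose_linear[OF g lie_bracket_linear(1)[OF br]])
  have gB: "g (B x y) z = g y (A x z)" for x y z
    unfolding A_def B_def by (rule g_transpose_works[OF g lie_bracket_linear(1)[OF br]])
  have gJ: "g (J x y) z = g x (A y z)" for x y z
    unfolding A_def J_def by (rule J_map_works[OF br g])
  have JB: "J x y = B y x" for x y by (simp add: J_def B_def J_map_def)
  have bA: "bilinear A" unfolding A_def by (rule lie_bracketD(1)[OF br])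
  have lJ: "linear (J x)" for x
    by (rule linearI; rule inner_product_eqI[OF g])
      (simp_all add: gJ bilinear_ladd[OF bg] bilinear_lmul[OF bg] bilinear_radd[OF bg]
        bilinear_rmul[OF bg] bilinear_ladd[OF bA] bilinear_lmul[OF bA])
  have gA: "g (A x y) z = g y (B x z)" for x y z
    using gB[of x z y] inner_productD(2)[OF g] by metis
  have Aneg: "A x y = - A y x" for x y unfolding A_def by (rule lie_bracketD(3)[OF br])
  have skew: "g (J x y) z = - g y (J x z)" for x y z
    using gJ[of x y z] gJ[of x z y] Aneg[of y z] inner_productD(2)[OF g]
    by (metis bilinear_rneg[OF bg])
  have nab1: "nab x y = (1/2) *\<^sub>R (A x y - B x y - J x y)" for x y
    using levi_civita_eq[OF br g] by (simp add: nab_def A_def J_def J_map_def B_def)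
  have nab2: "nab z y = - ((1/2) *\<^sub>R (A y z + B y z + J y z))" for y z
    unfolding nab1 JB Aneg[of z y] by (simp add: algebra_simps)
  have ln: "linear (nab x)" "linear (\<lambda>z. nab z x)" for x
    using bn unfolding bilinear_def by blast+
  have trA: "op_trace (A x) = 0" and trAA: "op_trace (\<lambda>z. A x (A y z)) = 0" for x y
    unfolding A_def by (rule nilpotent_traces[OF br nil])+
  have trB: "op_trace (B x) = 0" for x
    using op_trace_g_adjoint[of g "A x" "B x", OF g lA lB gB] trA[of x] by simp
  have trJ: "op_trace (J x) = 0" for x
  proof -
    have l: "linear (\<lambda>y. - J x y)" using linear_compose_neg[OF lJ] .
    have "op_trace (J x) = op_trace (\<lambda>y. - J x y)"
      by (rule op_trace_g_adjoint[OF g l lJ]) (simp only: skew bilinear_rneg[OF bg])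
    also have "\<dots> = - op_trace (J x)" by (rule op_trace_minus)
    finally show ?thesis by linarith
  qed
  have lin2: "linear (\<lambda>z. f (h z))" if "linear f" "linear h" for f h :: "real^'n \<Rightarrow> real^'n"
    using linear_compose[OF that(2,1)] by (simp add: o_def)
  have trBB: "op_trace (\<lambda>z. B x (B y z)) = 0" for x y
  proof -
    have "op_trace (\<lambda>z. B x (B y z)) = op_trace (\<lambda>z. A y (A x z))"
      by (rule op_trace_g_adjoint[OF g lin2[OF lA lA] lin2[OF lB lB]]) (simp add: gB)
    then show ?thesis by (simp add: trAA)
  qed
  have trBA: "op_trace (\<lambda>z. B x (A y z)) = op_trace (\<lambda>z. A x (B y z))" for x y
  proof -
    have "op_trace (\<lambda>z. B x (A y z)) = op_trace (\<lambda>z. B y (A x z))"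
      by (rule op_trace_g_adjoint[OF g lin2[OF lB lA] lin2[OF lB lA]]) (simp add: gB gA)
    then show ?thesis using op_trace_comm[OF lB lA] by simp
  qed
  have trAB: "op_trace (\<lambda>z. A x (B y z)) = op_trace (\<lambda>z. A y (B x z))" for x y
    using trBA[of x y] op_trace_comm[OF lB lA, of x y] by simp
  have cross: "op_trace (\<lambda>z. A x (J y z)) = - op_trace (\<lambda>z. B x (J y z))" for x y
  proof -
    have "op_trace (\<lambda>z. A x (J y z)) = op_trace (\<lambda>z. - J y (B x z))"
      by (rule op_trace_g_adjoint[OF g linear_compose_neg[OF lin2[OF lJ lB]] lin2[OF lA lJ]])
        (simp only: gA skew bilinear_rneg[OF bg])
    also have "\<dots> = - op_trace (\<lambda>z. B x (J y z))"
      using op_trace_comm[OF lJ lB] by (simp add: op_trace_minus)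
    finally show ?thesis .
  qed
  have "ricci br g u v = op_trace (\<lambda>w. nab w (nab u v) - nab u (nab w v) - nab (A w u) v)"
    by (simp add: ricci_def riemann_def Let_def nab_def A_def)
  also have "\<dots> = op_trace (\<lambda>w. nab w (nab u v)) - op_trace (\<lambda>w. nab u (nab w v))
                  - op_trace (\<lambda>w. nab (A w u) v)"
    by (simp add: op_trace_diff)
  also have "op_trace (\<lambda>w. nab w (nab u v)) = 0"
    by (simp only: nab2 op_trace_minus op_trace_scale op_trace_add trA trB trJ) simp
  also have "op_trace (\<lambda>w. nab u (nab w v)) = op_trace (\<lambda>w. nab (nab u w) v)"
    by (rule op_trace_comm[OF ln])
  also have "op_trace (\<lambda>w. nab (A w u) v) = op_trace (\<lambda>w. - nab (A u w) v)"
    by (simp add: Aneg[of _ u] bilinear_lneg[OF bn])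
  finally have "ricci br g u v = op_trace (\<lambda>w. nab (A u w) v - nab (nab u w) v)"
    by (simp add: op_trace_minus op_trace_diff)
  also have "(\<lambda>w. nab (A u w) v - nab (nab u w) v)
      = (\<lambda>w. (- (1/4)) *\<^sub>R (
          (A v (A u w) + A v (B u w) + A v (J u w)) + (B v (A u w) + B v (B u w) + B v (J u w))
          + (J v (A u w) + J v (B u w) + J v (J u w))))"
  proof
    fix w
    have "nab (A u w) v - nab (nab u w) v = nab (A u w - nab u w) v"
      by (simp add: bilinear_lsub[OF bn])
    also have "A u w - nab u w = (1/2) *\<^sub>R (A u w + B u w + J u w)"
      unfolding nab1 by (simp add: vec_eq_iff field_simps)
    also have "nab \<dots> v = (1/2) *\<^sub>R nab (A u w + B u w + J u w) v"
      by (rule bilinear_lmul[OF bn])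
    finally show "nab (A u w) v - nab (nab u w) v = (- (1/4)) *\<^sub>R (
          (A v (A u w) + A v (B u w) + A v (J u w)) + (B v (A u w) + B v (B u w) + B v (J u w))
          + (J v (A u w) + J v (B u w) + J v (J u w)))"
      by (simp add: nab2 linear_add[OF lA] linear_add[OF lB] linear_add[OF lJ])
  qed
  also have "op_trace \<dots> = - (1/4) * (2 * op_trace (\<lambda>w. A u (B v w)) + op_trace (\<lambda>w. J u (J v w)))"
    unfolding op_trace_scale op_trace_add
    using cross[of v u] cross[of u v] trAA[of v u] trBB[of v u] trBA[of v u] trAB[of v u]
      op_trace_comm[OF lJ lA, of v u] op_trace_comm[OF lJ lB, of v u] op_trace_comm[OF lJ lJ, of v u]
    by simp
  finally show ?thesis by (simp add: A_def B_def J_def o_def field_simps)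
qed

end

theory Submission
  imports Defs
begin

text \<open>The bracket is \<open>[x, y] = \<omega>(x, y) z\<close> with \<open>\<omega> = g(a, \<cdot>) \<and> g(b, \<cdot>)\<close> and \<open>a, b\<close> orthogonal to \<open>z\<close>.
  Let \<open>W\<close> be the \<open>g\<close>-skew operator with \<open>\<omega>(x, y) = g(W x, y)\<close>, and let \<open>\<Delta>\<close> be the Gram determinant
  of \<open>a, b\<close>. The Ricci formula for nilpotent algebras gives
  \<open>Ric x = 1/2 |z|\<^sup>2 W\<^sup>2 x + 1/2 \<Delta> g(x, z) z\<close>. As \<open>W\<^sup>3 = - \<Delta> W\<close>, replacing one argument of \<open>\<omega>\<close> by its image
  under \<open>Ric\<close> multiplies \<open>\<omega>\<close> by \<open>- 1/2 \<Delta> |z|\<^sup>2\<close>, while \<open>Ric z = 1/2 \<Delta> |z|\<^sup>2 z\<close>. Hence \<open>Ric - c Id\<close> is a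
  derivation for the \<open>c\<close> with \<open>1/2 \<Delta> |z|\<^sup>2 - c = 2 (- 1/2 \<Delta> |z|\<^sup>2 - c)\<close>, that is
  \<open>c = - 3/2 \<Delta> |z|\<^sup>2\<close>.\<close>

text \<open>Expanding \<open>c\<close> in the standard basis turns \<open>\<phi> c\<close> into the
  diagonal sum. Both traces in the Ricci formula will be taken of linear combinations of such
  operators.\<close>

lemma op_trace_rank_one:
  fixes \<phi> :: "real^'n \<Rightarrow> real"
  assumes "linear \<phi>"
  shows "op_trace (\<lambda>x. \<phi> x *\<^sub>R c) = \<phi> c"
proof -
  have "\<phi> c = \<phi> (\<Sum>i\<in>UNIV. (c $ i) *\<^sub>R axis i 1)"
    by (simp add: basis_expansion scalar_mult_eq_scaleR[symmetric])
  also have "\<dots> = (\<Sum>i\<in>UNIV. (c $ i) * \<phi> (axis i 1))"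
    by (simp add: linear_sum[OF assms] linear_scale[OF assms])
  finally show ?thesis by (simp add: trace_def matrix_def mult.commute)
qed

text \<open>All brackets lie on a central line, so the lower central series vanishes at its second
  step. This makes \<open>ricci_nilpotent\<close> applicable.\<close>

lemma nilpotent_lie_if_image_central:
  fixes br :: "real^'n \<Rightarrow> real^'n \<Rightarrow> real^'n"
  assumes br: "lie_bracket br" and range: "\<And>x y. br x y \<in> span {z}" and z: "\<And>x. br x z = 0"
  shows "nilpotent_lie br"
proof -
  have "lower_central br 1 \<subseteq> span {z}"
    unfolding One_nat_def lower_central.simps by (rule span_minimal) (auto simp: range)
  moreover have "br x y = 0" if "y \<in> span {z}" for x y
    using that z[of x] by (auto simp: span_singleton linear_scale[OF lie_bracket_linear(1)[OF br]])
  ultimately have "lower_central br (Suc 1) \<subseteq> span {0}"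
    unfolding lower_central.simps by (intro span_mono) blast
  moreover have "0 \<in> lower_central br (Suc 1)"
    by (intro subspace_0 lower_central_filtration(1)[OF br])
  ultimately have "lower_central br (Suc 1) = {0}" by auto
  then show ?thesis unfolding nilpotent_lie_def by blast
qed

lemma nilsoliton_rank_two_form:
  fixes br :: "real^'n \<Rightarrow> real^'n \<Rightarrow> real^'n"
  assumes br: "lie_bracket br" and g: "inner_product g"
    and br_eq: "\<And>x y. br x y = (g a x * g b y - g b x * g a y) *\<^sub>R z"
    and az: "g a z = 0" and bz: "g b z = 0"
  shows "nilsoliton br g"
proof -
  note bg = inner_productD(1)[OF g]
  note lin = bilinear_ladd[OF bg] bilinear_lmul[OF bg] bilinear_lsub[OF bg]
    bilinear_radd[OF bg] bilinear_rmul[OF bg] bilinear_rsub[OF bg]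
  have sym: "g x y = g y x" for x y by (rule inner_productD(2)[OF g])
  have lg: "linear (g x)" "linear (\<lambda>y. g y x)" for x
    using bg unfolding bilinear_def by blast+
  define \<omega> where "\<omega> x y = g a x * g b y - g b x * g a y" for x y
  define W where "W x = g a x *\<^sub>R b - g b x *\<^sub>R a" for x
  define \<Delta> where "\<Delta> = g a a * g b b - g a b * g a b"
  define N where "N = g z z"
  have br\<omega>: "br x y = \<omega> x y *\<^sub>R z" for x y by (simp add: br_eq \<omega>_def)
  have gW: "g (W x) y = \<omega> x y" for x y by (simp add: W_def \<omega>_def lin)
  have \<omega>skew: "\<omega> x y = - \<omega> y x" for x y by (simp add: \<omega>_def)
  have lW: "linear W"
    by (rule linearI) (simp_all add: W_def lin algebra_simps)
  have l\<omega>: "linear (\<omega> x)" "linear (\<lambda>y. \<omega> y x)" for x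
    by (rule linearI; simp add: \<omega>_def lin algebra_simps)+
  have \<omega>z: "\<omega> z x = 0" "\<omega> x z = 0" for x by (simp_all add: \<omega>_def az bz)
  \<comment> \<open>This is W^3 = - \<Delta> W read through \<omega>: \<open>W\<close> maps into the
    span of \<open>a\<close> and \<open>b\<close>, where its matrix has trace 0 and determinant
    \<Delta>.\<close>
  have \<omega>WW: "\<omega> (W (W x)) y = - \<Delta> * \<omega> x y" "\<omega> x (W (W y)) = - \<Delta> * \<omega> x y" for x y
    by (simp_all add: \<omega>_def W_def \<Delta>_def lin sym[of b a] algebra_simps)
  have WWz: "W (W z) = 0" by (simp add: W_def az bz linear_0[OF lg(1)])
  have transpose: "g_transpose g (br v) = (\<lambda>x. g x z *\<^sub>R W v)" for v
    by (rule g_transpose_eqI[OF g lie_bracket_linear(1)[OF br]]) (simp add: br\<omega> lin gW)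
  have J: "J_map br g u = (\<lambda>v. g u z *\<^sub>R W v)" for u
    by (rule ext) (simp add: J_map_def transpose)

  have "nilpotent_lie br"
    by (rule nilpotent_lie_if_image_central[OF br, of z]) (simp_all add: br\<omega> \<omega>z span_base span_scale)
  note ric = ricci_nilpotent[OF br this g]
  have tr1: "op_trace (br u \<circ> g_transpose g (br v)) = - N * g (W (W u)) v" for u v
  proof -
    have "br u \<circ> g_transpose g (br v) = (\<lambda>x. \<omega> u (W v) *\<^sub>R (g x z *\<^sub>R z))"
      by (rule ext) (simp add: transpose br\<omega> linear_scale[OF l\<omega>(1)] mult.commute)
    \<comment> \<open>Skewness moves \<open>W\<close> across \<open>g\<close>: both sides equal
      \<open>g (W u) (W v)\<close>.\<close>
    moreover have "\<omega> u (W v) = - g (W (W u)) v"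
      using gW[of u "W v"] gW[of v "W u"] gW[of "W u" v] sym[of "W u" "W v"] \<omega>skew[of v "W u"] by simp
    ultimately show ?thesis
      by (simp only: op_trace_scale op_trace_rank_one[OF lg(2)]) (simp add: N_def)
  qed
  have trW: "op_trace (\<lambda>x. W (W x)) = - 2 * \<Delta>"
  proof -
    have lc: "linear (\<lambda>x. g c (W x))" for c
      using linear_compose[OF lW lg(1)[of c]] by (simp add: o_def)
    \<comment> \<open>Unfolding only the outer \<open>W\<close> exhibits its square as a difference
      of two rank-one operators.\<close>
    have "(\<lambda>x. W (W x)) = (\<lambda>x. g a (W x) *\<^sub>R b - g b (W x) *\<^sub>R a)"
      by (subst W_def) simp
    then have "op_trace (\<lambda>x. W (W x)) = g a (W b) - g b (W a)"
      by (simp add: op_trace_diff op_trace_rank_one[OF lc])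
    then show ?thesis
      by (simp add: W_def \<Delta>_def lin sym[of b a] algebra_simps)
  qed
  have tr2: "op_trace (J_map br g u \<circ> J_map br g v) = - 2 * \<Delta> * g u z * g v z" for u v
  proof -
    have "J_map br g u \<circ> J_map br g v = (\<lambda>x. (g u z * g v z) *\<^sub>R W (W x))"
      by (rule ext) (simp add: J linear_scale[OF lW])
    then show ?thesis by (simp only: op_trace_scale trW) simp
  qed
  define R where "R x = (N / 2) *\<^sub>R W (W x) + (\<Delta> / 2 * g x z) *\<^sub>R z" for x
  have Ric: "ricci_operator br g = R"
  proof (intro ext, rule inner_product_eqI[OF g])
    fix u v
    show "g (ricci_operator br g u) v = g (R u) v"
      unfolding ricci_operator_works[OF br g, symmetric] ric tr1 tr2
      by (simp add: R_def lin sym[of z v])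
  qed
  have lR: "linear R"
    by (rule linearI)
      (simp_all add: R_def linear_add[OF lW] linear_scale[OF lW] lin algebra_simps)
  have Rz: "R z = (N * \<Delta> / 2) *\<^sub>R z"
    by (simp add: R_def WWz N_def)
  have \<omega>R: "\<omega> (R x) y = - (N * \<Delta> / 2) * \<omega> x y" "\<omega> x (R y) = - (N * \<Delta> / 2) * \<omega> x y" for x y
    by (simp_all add: R_def linear_add[OF l\<omega>(1)] linear_add[OF l\<omega>(2)]
        linear_scale[OF l\<omega>(1)] linear_scale[OF l\<omega>(2)] \<omega>WW \<omega>z)

  define c where "c = - 3 / 2 * N * \<Delta>"
  define D where "D x = R x - c *\<^sub>R x" for x
  have "linear D"
    by (rule linearI) (simp_all add: D_def linear_add[OF lR] linear_scale[OF lR] algebra_simps)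
  moreover have "D (br x y) = br (D x) y + br x (D y)" for x y
  proof -
    \<comment> \<open>Subtracting \<open>c\<close> turns the factor N \<Delta> / 2 on
      \<open>z\<close> into 2 N \<Delta> and the factor - N \<Delta> / 2 on each argument of
      \<omega> into N \<Delta>; the Leibniz rule is then 2 = 1 + 1.\<close>
    have "D (br x y) = (2 * N * \<Delta> * \<omega> x y) *\<^sub>R z"
      by (simp add: D_def br\<omega> linear_scale[OF lR] Rz c_def algebra_simps flip: scaleR_left.diff scaleR_left.add)
    moreover have "\<omega> (D x) y = N * \<Delta> * \<omega> x y" "\<omega> x (D y) = N * \<Delta> * \<omega> x y"
      by (simp_all add: D_def linear_diff[OF l\<omega>(1)] linear_diff[OF l\<omega>(2)]
        linear_scale[OF l\<omega>(1)] linear_scale[OF l\<omega>(2)] \<omega>R, simp_all add: c_def)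
    ultimately show ?thesis
      by (simp add: br\<omega> flip: scaleR_left.add)
  qed
  ultimately have "lie_derivation br D" unfolding lie_derivation_def by blast
  moreover have "ricci_operator br g = (\<lambda>x. c *\<^sub>R x + D x)" by (simp add: Ric D_def)
  ultimately show ?thesis unfolding nilsoliton_def by blast
qed

text \<open>Take for \<open>p\<close> and \<open>q\<close> the functionals dual to
  \<open>v 1\<close> and \<open>v 2\<close>, and \<alpha> times \<open>v 5\<close> for
  \<open>z\<close>. Both sides are bilinear and agree on the basis.\<close>

lemma A31_plus_2A1_bracket:
  assumes "A31_plus_2A1 br"
  obtains p q :: "real^5 \<Rightarrow> real" and z where "linear p" "linear q" "p z = 0" "q z = 0"
    "\<And>x y. br x y = (p x * q y - q x * p y) *\<^sub>R z"
proof -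
  have br: "lie_bracket br" using assms unfolding A31_plus_2A1_def by blast
  obtain v :: "nat \<Rightarrow> real^5" and \<alpha> :: real where
    inj: "inj_on v {1..5}" and ind: "independent (v ` {1..5})" and sp: "span (v ` {1..5}) = UNIV"
    and brv: "\<forall>i\<in>{1..5}. \<forall>j\<in>{1..5}. i < j \<longrightarrow>
           br (v i) (v j) = (if i = 1 \<and> j = 2 then \<alpha> *\<^sub>R v 5 else 0)"
    using assms unfolding A31_plus_2A1_def by (elim conjE exE) (rule that)
  have dual: "\<exists>p. linear p \<and> (\<forall>i\<in>{1..5}. p (v i) = (if i = k then 1 else 0 :: real))"
    if "k \<in> {1..5}" for k
  proof -
    \<comment> \<open>Injectivity of \<open>v\<close> turns the test \<open>v i = v k\<close> into
      \<open>i = k\<close>.\<close>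
    let ?f = "\<lambda>x. if x = v k then 1 else 0 :: real"
    obtain p where p: "linear p" "\<forall>x\<in>v ` {1..5}. p x = ?f x"
      using linear_independent_extend[OF ind, of ?f] by blast
    have "p (v i) = (if i = k then 1 else 0)" if "i \<in> {1..5}" for i
      using p(2) that \<open>k \<in> {1..5}\<close> inj_on_eq_iff[OF inj] by simp
    with p(1) show ?thesis by blast
  qed
  obtain p where p: "linear p" "\<And>i. i \<in> {1..5} \<Longrightarrow> p (v i) = (if i = 1 then 1 else 0 :: real)"
    using dual[of 1] by auto
  obtain q where q: "linear q" "\<And>i. i \<in> {1..5} \<Longrightarrow> q (v i) = (if i = 2 then 1 else 0 :: real)"
    using dual[of 2] by auto
  define z where "z = \<alpha> *\<^sub>R v 5"
  have pz: "p z = 0" "q z = 0"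
    by (simp_all add: z_def linear_scale[OF p(1)] linear_scale[OF q(1)] p(2) q(2))
  define f where "f x y = (p x * q y - q x * p y) *\<^sub>R z" for x y
  have bf: "bilinear f"
    unfolding bilinear_def
    by (intro conjI allI linearI)
      (simp_all add: f_def linear_add[OF p(1)] linear_add[OF q(1)] linear_scale[OF p(1)]
        linear_scale[OF q(1)] algebra_simps)
  have on_basis: "br (v i) (v j) = f (v i) (v j)" if "i \<in> {1..5}" "j \<in> {1..5}" for i j
  proof (cases i j rule: linorder_cases)
    case less
    then show ?thesis using brv that by (auto simp: f_def p(2) q(2) z_def)
  next
    case equal
    then show ?thesis using lie_bracketD(2)[OF br] by (simp add: f_def mult.commute)
  next
    case greater
    then show ?thesis
      using brv that lie_bracketD(3)[OF br, of "v i" "v j"] by (auto simp: f_def p(2) q(2) z_def)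
  qed
  have "br x y = f x y" for x y
    by (rule bilinear_eq[OF lie_bracketD(1)[OF br] bf,
          of UNIV "v ` {1..5}" UNIV "v ` {1..5}"])
      (use on_basis in \<open>auto simp: sp simp del: One_nat_def\<close>)
  then show ?thesis by (intro that[OF p(1) q(1) pz]) (simp add: f_def)
qed

theorem corollary2:
  fixes br :: "real^5 \<Rightarrow> real^5 \<Rightarrow> real^5" and g :: "real^5 \<Rightarrow> real^5 \<Rightarrow> real"
  assumes "A31_plus_2A1 br" and "inner_product g"
  shows "nilsoliton br g"
proof -
  have br: "lie_bracket br" using assms(1) unfolding A31_plus_2A1_def by blast
  obtain p q z where p: "linear p" and q: "linear q" and pz: "p z = 0" "q z = 0"
    and br_eq: "\<And>x y. br x y = (p x * q y - q x * p y) *\<^sub>R z"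
    by (rule A31_plus_2A1_bracket[OF assms(1)]) (rule that)
  \<comment> \<open>Riesz vectors of \<open>p\<close> and \<open>q\<close> bring in the given
    metric; \<open>p z = q z = 0\<close> becomes orthogonality to \<open>z\<close>.\<close>
  obtain a b where "\<forall>x. g a x = p x" "\<forall>x. g b x = q x"
    using ex1_implies_ex[OF riesz[OF assms(2) p]] ex1_implies_ex[OF riesz[OF assms(2) q]]
    by (elim exE) (rule that)
  with pz br_eq show ?thesis
    by (intro nilsoliton_rank_two_form[OF br assms(2), of a b z]) simp_all
qed

end
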